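(* Let $\mathfrak{g}$ be a (possibly infinite-dimensional) Lie algebra over $\mathbb{C}$ equipped with a non-degenerate symmetric invariant bilinear form $\langle\cdot,\cdot\rangle$, and let $p(x)\in\mathbb{C}[x]$. Set $$\check{\mathfrak{g}}_p=\mathbb{C}((z))\otimes(\mathfrak{g}\oplus\mathfrak{g}^1)\otimes\mathbb{C}[t,t^{-1}]\oplus\mathbb{C}((z))\mathbf{k},$$ a vector space over $\mathbb{C}((z))$. Define a $\mathbb{C}((z))$-bilinear operation $[\cdot,\cdot]$ on $\check{\mathfrak{g}}_p$ by $[\mathbf{k},\check{\mathfrak{g}}_p]=0=[\check{\mathfrak{g}}_p,\mathbf{k}]$ and, for $a,b\in\mathfrak{g}$, $$[a(x_1),b(x_2)]=[a,b](x_2)x_2^{-1}\delta\left(\frac{x_1}{x_2}\right)+\langle a,b\rangle\mathbf{k}\frac{\partial}{\partial x_2}x_2^{-1}\delta\left(\frac{x_1}{x_2}\right),$$ $$[a(x_1),b^1(x_2)]=[a,b]^1(x_2)x_2^{-1}\delta\left(\frac{x_1}{x_2}\right),\qquad [a^1(x_1),b(x_2)]=[a,b]^1(x_2)x_2^{-1}\delta\left(\frac{x_1}{x_2}\right),$$ $$[a^1(x_1),b^1(x_2)]=p(z+x_2)[a,b](x_2)x_2^{-1}\delta\left(\frac{x_1}{x_2}\right)+\frac12\langle a,b\rangle p'(z+x_2)\mathbf{k}\,x_2^{-1}\delta\left(\frac{x_1}{x_2}\right)+\langle a,b\rangle p(z+x_2)\mathbf{k}\frac{\partial}{\partial x_2}x_2^{-1}\delta\left(\frac{x_1}{x_2}\right).$$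 Then $\check{\mathfrak{g}}_p$ is a Lie algebra over $\mathbb{C}((z))$. Furthermore, the map $\check{D}$ defined by $$\check{D}(f(z)\mathbf{k})=f'(z)\mathbf{k},\qquad \check{D}(f(z)u\otimes t^n)=f'(z)u\otimes t^n-nf(z)u\otimes t^{n-1}$$ for $f(z)\in\mathbb{C}((z))$, $u\in\mathfrak{g}+\mathfrak{g}^1$, $n\in\mathbb{Z}$, is a $\mathbb{C}$-linear derivation of $\check{\mathfrak{g}}_p$ viewed as a Lie algebra over $\mathbb{C}$.
   Context: $\mathfrak{g}^1$ is a vector space with a fixed linear isomorphism $\mathfrak{g}\to\mathfrak{g}^1$, $a\mapsto a^1$. For $u\in\mathfrak{g}\oplus\mathfrak{g}^1$, $u(x)=\sum_{n\in\mathbb{Z}}(u\otimes t^n)x^{-n-1}$. Also $x_2^{-1}\delta(x_1/x_2)=\sum_{n\in\mathbb{Z}}x_1^{n}x_2^{-n-1}=\sum_{n\in\mathbb{Z}}x_2^{n}x_1^{-n-1}$, and $p(z+x_2),p'(z+x_2)\in\mathbb{C}[z,x_2]$ are the usual polynomial substitutions. Brackets are read off by comparing coefficients of $x_1^{-m-1}x_2^{-n-1}$ and extended $\mathbb{C}((z))$-bilinearly. Tensor products are over $\mathbb{C}$. *)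

theory Defs
  imports
    Complex_Main
    "HOL-Library.Poly_Mapping"
    "HOL-Library.Product_Plus"
    "HOL-Computational_Algebra.Formal_Laurent_Series"
begin

section \<open>Complex vector spaces\<close>

class complex_vector = ab_group_add +
  fixes scaleC :: "complex \<Rightarrow> 'a \<Rightarrow> 'a" (infixr \<open>*c\<close> 75)
  assumes scaleC_add_right: "a *c (x + y) = a *c x + a *c y"
    and scaleC_add_left: "(a + b) *c x = a *c x + b *c x"
    and scaleC_scaleC: "a *c b *c x = (a * b) *c x"
    and scaleC_one: "1 *c x = x"

interpretation cvec: vector_space "scaleC :: complex \<Rightarrow> 'a \<Rightarrow> 'a::complex_vector"
  by unfold_locales (simp_all add: scaleC_add_right scaleC_add_left scaleC_scaleC scaleC_one)

instantiation complex :: complex_vector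
begin
definition "c *c (z::complex) = c * z"
instance by standard (simp_all add: scaleC_complex_def algebra_simps)
end

instantiation prod :: (complex_vector, complex_vector) complex_vector
begin
definition "c *c x = (c *c fst x, c *c snd x)"
instance
  by standard (simp_all add: scaleC_prod_def prod_eq_iff scaleC_add_right scaleC_add_left)
end

instantiation poly_mapping :: (type, complex_vector) complex_vector
begin
definition "c *c f = Poly_Mapping.map (scaleC c) f"

lemma lookup_scaleC: "Poly_Mapping.lookup (c *c f) k = c *c Poly_Mapping.lookup f k"
  for f :: "'a \<Rightarrow>\<^sub>0 'b"
  unfolding scaleC_poly_mapping_def by transfer (simp add: when_def)

instance
  by standard (rule poly_mapping_eqI,
      simp add: lookup_scaleC lookup_add scaleC_add_right scaleC_add_left)+
end

instantiation fls :: (complex_vector) complex_vector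
begin
definition "c *c f = Abs_fls (\<lambda>n. c *c fls_nth f n)"

lemma fls_nth_scaleC: "fls_nth (c *c f) n = c *c fls_nth f n" for f :: "'a fls"
proof -
  have "\<forall>\<^sub>\<infinity>n::nat. c *c fls_nth f (- int n) = 0"
    using fls_nth[of f] by (auto elim: MOST_rev_mp)
  then show ?thesis
    unfolding scaleC_fls_def by simp
qed

instance
  by standard (rule fls_eqI,
      simp add: fls_nth_scaleC scaleC_add_right scaleC_add_left)+
end

lemma scaleC_fls_eq: "c *c f = fls_const c * f" for f :: "complex fls"
  by (rule fls_eqI) (simp add: fls_nth_scaleC scaleC_complex_def)


section \<open>Tensor products over the complex numbers\<close>

text \<open>The free complex vector space on pairs, modulo the span of the bilinearity relations.\<close>

definition tensor_relators :: "(('a::complex_vector \<times> 'b::complex_vector) \<Rightarrow>\<^sub>0 complex) set" where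
  "tensor_relators =
     {Poly_Mapping.single (a + a', b) 1 - Poly_Mapping.single (a, b) 1
        - Poly_Mapping.single (a', b) 1 | a a' b. True} \<union>
     {Poly_Mapping.single (a, b + b') 1 - Poly_Mapping.single (a, b) 1
        - Poly_Mapping.single (a, b') 1 | a b b'. True} \<union>
     {Poly_Mapping.single (c *c a, b) 1 - c *c Poly_Mapping.single (a, b) 1 | c a b. True} \<union>
     {Poly_Mapping.single (a, c *c b) 1 - c *c Poly_Mapping.single (a, b) 1 | c a b. True}"

quotient_type (overloaded) ('a, 'b) tensor =
  "('a::complex_vector \<times> 'b::complex_vector) \<Rightarrow>\<^sub>0 complex" /
  "\<lambda>x y. x - y \<in> cvec.span tensor_relators"
proof (rule equivpI)
  show "reflp (\<lambda>x y. x - y \<in> cvec.span (tensor_relators :: (('a \<times> 'b) \<Rightarrow>\<^sub>0 complex) set))"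
    by (simp add: reflp_def cvec.span_zero)
  show "symp (\<lambda>x y. x - y \<in> cvec.span (tensor_relators :: (('a \<times> 'b) \<Rightarrow>\<^sub>0 complex) set))"
    by (rule sympI, drule cvec.span_neg, simp)
  show "transp (\<lambda>x y. x - y \<in> cvec.span (tensor_relators :: (('a \<times> 'b) \<Rightarrow>\<^sub>0 complex) set))"
    by (rule transpI, drule (1) cvec.span_add, simp)
qed

instantiation tensor :: (complex_vector, complex_vector) complex_vector
begin

lift_definition zero_tensor :: "('a, 'b) tensor" is 0 .

lift_definition plus_tensor :: "('a, 'b) tensor \<Rightarrow> ('a, 'b) tensor \<Rightarrow> ('a, 'b) tensor"
  is "(+)"
  by (drule (1) cvec.span_add, simp only: add_diff_add)

lift_definition uminus_tensor :: "('a, 'b) tensor \<Rightarrow> ('a, 'b) tensor" is uminus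
  by (drule cvec.span_neg, simp only: minus_diff_minus)

lift_definition minus_tensor :: "('a, 'b) tensor \<Rightarrow> ('a, 'b) tensor \<Rightarrow> ('a, 'b) tensor"
  is "(-)"
  by (drule (1) cvec.span_diff, simp add: algebra_simps)

lift_definition scaleC_tensor :: "complex \<Rightarrow> ('a, 'b) tensor \<Rightarrow> ('a, 'b) tensor" is scaleC
  by (simp only: cvec.scale_right_diff_distrib[symmetric] cvec.span_scale)

instance
  by standard (transfer, simp add: cvec.span_zero algebra_simps)+

end

lift_definition tensor :: "'a::complex_vector \<Rightarrow> 'b::complex_vector \<Rightarrow> ('a, 'b) tensor"
    (infixr \<open>\<otimes>\<^sub>c\<close> 76)
  is "\<lambda>a b. Poly_Mapping.single (a, b) 1" .

definition free_extend :: "('k \<Rightarrow> 'v::complex_vector) \<Rightarrow> ('k \<Rightarrow>\<^sub>0 complex) \<Rightarrow> 'v" where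
  "free_extend \<phi> x = (\<Sum>k\<in>Poly_Mapping.keys x. Poly_Mapping.lookup x k *c \<phi> k)"

lemma free_extend_superset:
  assumes "finite A" "Poly_Mapping.keys x \<subseteq> A"
  shows "free_extend \<phi> x = (\<Sum>k\<in>A. Poly_Mapping.lookup x k *c \<phi> k)"
  unfolding free_extend_def using assms
  by (intro sum.mono_neutral_left) (auto simp: in_keys_iff)

lemma linear_free_extend: "Vector_Spaces.linear scaleC scaleC (free_extend \<phi>)"
proof unfold_locales
  fix x y :: "'a \<Rightarrow>\<^sub>0 complex" and c :: complex
  let ?A = "Poly_Mapping.keys x \<union> Poly_Mapping.keys y"
  have "free_extend \<phi> (x + y) = (\<Sum>k\<in>?A. Poly_Mapping.lookup (x + y) k *c \<phi> k)"
    by (rule free_extend_superset) (simp_all add: keys_add)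
  then show "free_extend \<phi> (x + y) = free_extend \<phi> x + free_extend \<phi> y"
    by (simp add: free_extend_superset[of ?A] lookup_add cvec.scale_left_distrib sum.distrib)
  have "free_extend \<phi> (c *c x) = (\<Sum>k\<in>Poly_Mapping.keys x. Poly_Mapping.lookup (c *c x) k *c \<phi> k)"
    by (rule free_extend_superset) (auto simp: in_keys_iff lookup_scaleC)
  then show "free_extend \<phi> (c *c x) = c *c free_extend \<phi> x"
    by (simp add: free_extend_def lookup_scaleC scaleC_complex_def cvec.scale_sum_right)
qed

lemma free_extend_single: "free_extend \<phi> (Poly_Mapping.single k 1) = \<phi> k"
  by (simp add: free_extend_def)


section \<open>Scalar extension to formal Laurent series\<close>

text \<open>
  Without the next command, \<open>lift_definition\<close> also lifts through the type argument
  \<open>complex fls\<close> of the tensor product.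
\<close>

lifting_forget fls.lifting

lift_definition fls_scale ::
    "complex fls \<Rightarrow> (complex fls, 'b::complex_vector) tensor \<Rightarrow> (complex fls, 'b) tensor"
  is "\<lambda>f. free_extend (\<lambda>(g, b). Poly_Mapping.single (f * g, b) 1)"
proof -
  fix f :: "complex fls" and x y :: "(complex fls \<times> 'b) \<Rightarrow>\<^sub>0 complex"
  let ?F = "free_extend (\<lambda>(g, b). Poly_Mapping.single (f * g, b) (1::complex))
    :: ((complex fls \<times> 'b) \<Rightarrow>\<^sub>0 complex) \<Rightarrow> _"
  interpret F: Vector_Spaces.linear scaleC scaleC ?F by (rule linear_free_extend)
  have single: "?F (Poly_Mapping.single (g, b) 1) = Poly_Mapping.single (f * g, b) 1" for g b
    by (simp add: free_extend_single)
  have mult: "f * c *c g = c *c (f * g)" for c g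
    by (simp add: scaleC_fls_eq mult.left_commute)
  have "?F r \<in> tensor_relators" if "r \<in> tensor_relators" for r
    using that unfolding tensor_relators_def
    by (elim UnE CollectE exE conjE; simp only: F.diff F.scale single mult distrib_left; blast)
  then have "?F ` tensor_relators \<subseteq> tensor_relators"
    by blast
  then have span: "?F ` cvec.span tensor_relators \<subseteq> cvec.span tensor_relators"
    unfolding F.span_image[symmetric] by (rule cvec.span_mono)
  assume "x - y \<in> cvec.span tensor_relators"
  then have "?F (x - y) \<in> cvec.span tensor_relators"
    using span by blast
  then show "?F x - ?F y \<in> cvec.span tensor_relators"
    by (simp only: F.diff)
qed

lemma fls_scale_tensor: "fls_scale f (g \<otimes>\<^sub>c b) = (f * g) \<otimes>\<^sub>c b"
  by transfer (simp add: free_extend_single cvec.span_zero)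


section \<open>Lie algebras and derivations\<close>

definition bilinear_over ::
    "('k::field \<Rightarrow> 'a::ab_group_add \<Rightarrow> 'a) \<Rightarrow> ('k \<Rightarrow> 'b::ab_group_add \<Rightarrow> 'b)
      \<Rightarrow> ('k \<Rightarrow> 'c::ab_group_add \<Rightarrow> 'c) \<Rightarrow> ('a \<Rightarrow> 'b \<Rightarrow> 'c) \<Rightarrow> bool" where
  "bilinear_over s1 s2 s3 \<beta> \<longleftrightarrow>
     (\<forall>x. Vector_Spaces.linear s2 s3 (\<lambda>y. \<beta> x y)) \<and>
     (\<forall>y. Vector_Spaces.linear s1 s3 (\<lambda>x. \<beta> x y))"

locale lie_algebra = vector_space scale
  for scale :: "'k::field \<Rightarrow> 'v::ab_group_add \<Rightarrow> 'v" +
  fixes bracket :: "'v \<Rightarrow> 'v \<Rightarrow> 'v"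
  assumes bilinear: "bilinear_over scale scale scale bracket"
    and alternating: "bracket x x = 0"
    and jacobi: "bracket x (bracket y z) + bracket y (bracket z x) + bracket z (bracket x y) = 0"

locale lie_derivation = lie_algebra scale bracket
  for scale :: "'k::field \<Rightarrow> 'v::ab_group_add \<Rightarrow> 'v" and bracket :: "'v \<Rightarrow> 'v \<Rightarrow> 'v" +
  fixes D :: "'v \<Rightarrow> 'v"
  assumes linear: "Vector_Spaces.linear scale scale D"
    and leibniz: "D (bracket x y) = bracket (D x) y + bracket x (D y)"

locale metric_lie_algebra = lie_algebra scale bracket
  for scale :: "'k::field \<Rightarrow> 'v::ab_group_add \<Rightarrow> 'v" and bracket :: "'v \<Rightarrow> 'v \<Rightarrow> 'v" +
  fixes form :: "'v \<Rightarrow> 'v \<Rightarrow> 'k"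
  assumes form_bilinear: "bilinear_over scale scale (*) form"
    and form_symmetric: "form x y = form y x"
    and form_invariant: "form (bracket x y) z = form x (bracket y z)"
    and form_nondegenerate: "(\<forall>y. form x y = 0) \<Longrightarrow> x = 0"


section \<open>The space underlying the algebra\<close>

text \<open>Laurent polynomials in \<open>t\<close>, as the finitely supported families of coefficients.\<close>

type_synonym laurent_poly = "int \<Rightarrow>\<^sub>0 complex"

definition t_pow :: "int \<Rightarrow> laurent_poly" where
  "t_pow n = Poly_Mapping.single n 1"

text \<open>The second component of a pair is the coefficient of the central element \<open>\<^bold>k\<close>.\<close>

type_synonym ('g, 'h) check_space =
  "(complex fls, ('g \<times> 'h, laurent_poly) tensor) tensor \<times> complex fls"

definition check_scale ::
    "complex fls \<Rightarrow> ('g::complex_vector, 'h::complex_vector) check_space \<Rightarrow> ('g, 'h) check_space"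
  where "check_scale f x = (fls_scale f (fst x), f * snd x)"

definition check_elem ::
    "complex fls \<Rightarrow> 'g \<times> 'h \<Rightarrow> int
      \<Rightarrow> ('g::complex_vector, 'h::complex_vector) check_space" where
  "check_elem f u n = (f \<otimes>\<^sub>c u \<otimes>\<^sub>c t_pow n, 0)"

definition check_central :: "('g::complex_vector, 'h::complex_vector) check_space" where
  "check_central = (0, 1)"

text \<open>Restriction of scalars from \<open>\<complex>((z))\<close> to \<open>\<complex>\<close>.\<close>

definition check_scaleC ::
    "complex \<Rightarrow> ('g::complex_vector, 'h::complex_vector) check_space \<Rightarrow> ('g, 'h) check_space"
  where "check_scaleC c = check_scale (fls_const c)"


section \<open>Formal distributions\<close>

text \<open>
  A formal distribution is its family of coefficients: \<open>A i\<close> is the coefficient of \<open>x\<^sup>i\<close>, and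
  \<open>F i j\<close> is the coefficient of \<open>x\<^sub>1\<^sup>i x\<^sub>2\<^sup>j\<close>.
\<close>

definition gen_field ::
    "'g \<times> 'h \<Rightarrow> int \<Rightarrow> ('g::complex_vector, 'h::complex_vector) check_space" where
  "gen_field u i = check_elem 1 u (- i - 1)"

definition bracket_dist ::
    "('v \<Rightarrow> 'v \<Rightarrow> 'v) \<Rightarrow> (int \<Rightarrow> 'v) \<Rightarrow> (int \<Rightarrow> 'v) \<Rightarrow> int \<Rightarrow> int \<Rightarrow> 'v" where
  "bracket_dist br A B i j = br (A i) (B j)"

text \<open>\<open>x\<^sub>2\<^sup>-\<^sup>1 \<delta>(x\<^sub>1/x\<^sub>2) = \<Sum>\<^sub>n x\<^sub>1\<^sup>n x\<^sub>2\<^sup>-\<^sup>n\<^sup>-\<^sup>1\<close>\<close>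

definition delta_dist :: "int \<Rightarrow> int \<Rightarrow> complex fls" where
  "delta_dist i j = (if j = - i - 1 then 1 else 0)"

definition deriv_x2 :: "(int \<Rightarrow> int \<Rightarrow> complex fls) \<Rightarrow> int \<Rightarrow> int \<Rightarrow> complex fls" where
  "deriv_x2 F i j = of_int (j + 1) * F i (j + 1)"

text \<open>
  The product \<open>A(x\<^sub>2) F(x\<^sub>1, x\<^sub>2)\<close>. It is used only for \<open>F = x\<^sub>2\<^sup>-\<^sup>1 \<delta>(x\<^sub>1/x\<^sub>2)\<close>, where every sum
  over \<open>k\<close> has at most one nonzero term.
\<close>

definition dist_mult ::
    "(int \<Rightarrow> ('g, 'h) check_space) \<Rightarrow> (int \<Rightarrow> int \<Rightarrow> complex fls)
      \<Rightarrow> int \<Rightarrow> int \<Rightarrow> ('g::complex_vector, 'h::complex_vector) check_space" where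
  "dist_mult A F i j = Sum_any (\<lambda>k. check_scale (F i (j - k)) (A k))"

definition central_dist ::
    "(int \<Rightarrow> int \<Rightarrow> complex fls)
      \<Rightarrow> int \<Rightarrow> int \<Rightarrow> ('g::complex_vector, 'h::complex_vector) check_space" where
  "central_dist F i j = check_scale (F i j) check_central"

text \<open>
  \<open>p(z + x\<^sub>2)\<close> as a polynomial in \<open>x\<^sub>2\<close> with coefficients in \<open>\<complex>((z))\<close>, and the product of such a
  polynomial with a distribution.
\<close>

definition poly_shift :: "complex poly \<Rightarrow> complex fls poly" where
  "poly_shift p = pcompose (map_poly fls_const p) [:fls_X, 1:]"

definition poly_x2_mult ::
    "complex fls poly \<Rightarrow> (int \<Rightarrow> int \<Rightarrow> ('g, 'h) check_space)
      \<Rightarrow> int \<Rightarrow> int \<Rightarrow> ('g::complex_vector, 'h::complex_vector) check_space" where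
  "poly_x2_mult P F i j = (\<Sum>k\<le>degree P. check_scale (coeff P k) (F i (j - int k)))"

definition dist_add :: "(int \<Rightarrow> int \<Rightarrow> 'v) \<Rightarrow> (int \<Rightarrow> int \<Rightarrow> 'v) \<Rightarrow> int \<Rightarrow> int \<Rightarrow> 'v::plus"
    (infixl \<open>\<oplus>\<^sub>d\<close> 65) where
  "(F \<oplus>\<^sub>d G) i j = F i j + G i j"

definition dist_smult ::
    "complex \<Rightarrow> (int \<Rightarrow> int \<Rightarrow> ('g, 'h) check_space)
      \<Rightarrow> int \<Rightarrow> int \<Rightarrow> ('g::complex_vector, 'h::complex_vector) check_space" where
  "dist_smult c F i j = check_scaleC c (F i j)"


section \<open>The bracket and the derivation\<close>

text \<open>
  The four equations of distributions prescribe the bracket on the generators; \<open>\<complex>((z))\<close>-bilinearity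
  then determines it. Here \<open>up\<close> is the linear isomorphism \<open>a \<mapsto> a\<^sup>1\<close>; \<open>a\<close> and \<open>a\<^sup>1\<close> sit in the direct sum as
  \<open>(a, 0)\<close> and \<open>(0, up a)\<close>.
\<close>

definition is_check_bracket ::
    "('g \<Rightarrow> 'g \<Rightarrow> 'g) \<Rightarrow> ('g \<Rightarrow> 'g \<Rightarrow> complex) \<Rightarrow> ('g \<Rightarrow> 'h) \<Rightarrow> complex poly
      \<Rightarrow> (('g, 'h) check_space \<Rightarrow> ('g, 'h) check_space
            \<Rightarrow> ('g::complex_vector, 'h::complex_vector) check_space) \<Rightarrow> bool" where
  "is_check_bracket lie form up p br \<longleftrightarrow>
     bilinear_over check_scale check_scale check_scale br \<and>
     (\<forall>x. br check_central x = 0 \<and> br x check_central = 0) \<and>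
     (\<forall>a b.
        bracket_dist br (gen_field (a, 0)) (gen_field (b, 0)) =
          dist_mult (gen_field (lie a b, 0)) delta_dist
          \<oplus>\<^sub>d dist_smult (form a b) (central_dist (deriv_x2 delta_dist)) \<and>
        bracket_dist br (gen_field (a, 0)) (gen_field (0, up b)) =
          dist_mult (gen_field (0, up (lie a b))) delta_dist \<and>
        bracket_dist br (gen_field (0, up a)) (gen_field (b, 0)) =
          dist_mult (gen_field (0, up (lie a b))) delta_dist \<and>
        bracket_dist br (gen_field (0, up a)) (gen_field (0, up b)) =
          poly_x2_mult (poly_shift p) (dist_mult (gen_field (lie a b, 0)) delta_dist)
          \<oplus>\<^sub>d dist_smult (1/2 * form a b)
                (poly_x2_mult (poly_shift (pderiv p)) (central_dist delta_dist))
          \<oplus>\<^sub>d dist_smult (form a b)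
                (poly_x2_mult (poly_shift p) (central_dist (deriv_x2 delta_dist))))"

text \<open>
  Only additivity is imposed besides the two formulas, since \<open>f\<close> ranges over all of \<open>\<complex>((z))\<close>;
  linearity over \<open>\<complex>\<close> is part of \<^locale>\<open>lie_derivation\<close>.
\<close>

definition is_check_D ::
    "(('g, 'h) check_space \<Rightarrow> ('g::complex_vector, 'h::complex_vector) check_space) \<Rightarrow> bool" where
  "is_check_D D \<longleftrightarrow>
     additive D \<and>
     (\<forall>f. D (check_scale f check_central) = check_scale (fls_deriv f) check_central) \<and>
     (\<forall>f u n. D (check_elem f u n) =
        check_elem (fls_deriv f) u n - check_elem (of_int n * f) u (n - 1))"

end

theory Submission
  imports Defs
begin

text \<open>
  Let \<open>A = \<complex>((z))[t, t\<^sup>-\<^sup>1][w] / (w\<^sup>2 - p(z + t))\<close>, a commutative algebra, and read \<open>a\<^sup>1 \<otimes> t\<^sup>n\<close> as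
  \<open>a \<otimes> w t\<^sup>n\<close>. Then the algebra in question is the central extension of \<open>\<gg> \<otimes> A\<close> with bracket
  \<open>[a \<otimes> f, b \<otimes> g] = [a, b] \<otimes> f g + \<langle>a, b\<rangle> \<phi>(f, g) \<^bold>k\<close>. Here \<open>\<phi>\<close> is skew, \<open>\<phi>(t\<^sup>m, t\<^sup>n)\<close> is \<open>m\<close> if
  \<open>m + n = 0\<close> and \<open>0\<close> otherwise, \<open>\<phi>(t\<^sup>m, w t\<^sup>n) = 0\<close>, and \<open>\<phi>(w t\<^sup>m, w t\<^sup>n) = (m - n)/2 \<cdot> c\<^bsub>-m-n\<^esub>\<close>, where
  \<open>p(z + x) = \<Sum>\<^sub>k c\<^sub>k x\<^sup>k\<close>. Since \<open>\<langle>a, [b, c]\<rangle>\<close> is cyclic, the Jacobi identity reduces to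
  \<open>\<phi>(f, g h) + \<phi>(g, h f) + \<phi>(h, f g) = 0\<close>. The map \<open>D\<close> comes from the derivation \<open>\<partial>\<^sub>z - \<partial>\<^sub>t\<close>, which
  kills \<open>p(z + t)\<close> and hence extends to \<open>A\<close> by killing \<open>w\<close>. All identities are multiadditive and
  compatible with scalars, so that they need only be checked on \<open>a \<otimes> t\<^sup>n\<close>, \<open>a \<otimes> w t\<^sup>n\<close> and \<open>\<^bold>k\<close>.
\<close>

section \<open>The universal property of the tensor product\<close>

lemma free_extend_single_id:
  fixes x :: "'k \<Rightarrow>\<^sub>0 complex"
  shows "free_extend (\<lambda>k. Poly_Mapping.single k 1) x = x"
proof -
  have "free_extend (\<lambda>k. Poly_Mapping.single k (1::complex)) x =
    (\<Sum>k\<in>Poly_Mapping.keys x. Poly_Mapping.single k (Poly_Mapping.lookup x k))"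
    unfolding free_extend_def
    by (intro sum.cong refl poly_mapping_eqI)
      (simp add: lookup_scaleC scaleC_complex_def lookup_single when_def)
  then show ?thesis
    by (simp add: poly_mapping_eqI lookup_sum lookup_single when_def in_keys_iff)
qed

lemma tensor_add_left: "(a + a') \<otimes>\<^sub>c b = a \<otimes>\<^sub>c b + a' \<otimes>\<^sub>c b"
  by transfer
    \<comment> \<open>The relators have the form \<open>x - y - z\<close>, whereas the transferred
      goal is about \<open>x - (y + z)\<close>.\<close>
    (rule cvec.span_base, simp only: diff_diff_eq[symmetric], unfold tensor_relators_def, blast)

lemma tensor_add_right: "a \<otimes>\<^sub>c (b + b') = a \<otimes>\<^sub>c b + a \<otimes>\<^sub>c b'"
  by transfer
    (rule cvec.span_base, simp only: diff_diff_eq[symmetric], unfold tensor_relators_def, blast)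

lemma tensor_scaleC_left: "(c *c a) \<otimes>\<^sub>c b = c *c (a \<otimes>\<^sub>c b)"
  by transfer (rule cvec.span_base, unfold tensor_relators_def, blast)

lemma tensor_scaleC_right: "a \<otimes>\<^sub>c (c *c b) = c *c (a \<otimes>\<^sub>c b)"
  by transfer (rule cvec.span_base, unfold tensor_relators_def, blast)

lemma tensor_zero_left [simp]: "0 \<otimes>\<^sub>c b = 0"
  using tensor_scaleC_left[of 0 0 b] by simp

text \<open>Complex coefficients can be absorbed into the left factor, so every tensor is a sum of
  pure tensors and closure under scalars need not be assumed.\<close>

lemma tensor_induct [case_names tensor add]:
  assumes "\<And>a b. P (a \<otimes>\<^sub>c b)" and "\<And>x y. P x \<Longrightarrow> P y \<Longrightarrow> P (x + y)"
  shows "P x"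
proof -
  interpret T: Vector_Spaces.linear scaleC scaleC "abs_tensor :: _ \<Rightarrow> ('a, 'b) tensor"
    by unfold_locales (simp_all add: plus_tensor.abs_eq scaleC_tensor.abs_eq)
  obtain r where "x = abs_tensor r"
    using Quotient3_abs_rep[OF Quotient3_tensor, of x] by metis
  also have "\<dots> = abs_tensor (free_extend (\<lambda>k. Poly_Mapping.single k 1) r)"
    by (simp add: free_extend_single_id)
  also have "\<dots> = (\<Sum>k\<in>Poly_Mapping.keys r.
      Poly_Mapping.lookup r k *c abs_tensor (Poly_Mapping.single k 1))"
    by (simp add: free_extend_def T.sum T.scale)
  also have "\<dots> = (\<Sum>k\<in>Poly_Mapping.keys r. (Poly_Mapping.lookup r k *c fst k) \<otimes>\<^sub>c snd k)"
    by (simp only: tensor_scaleC_left, simp only: tensor.abs_eq prod.collapse)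
  finally have x: "x = \<dots>" .
  have "P (\<Sum>k\<in>A. (Poly_Mapping.lookup r k *c fst k) \<otimes>\<^sub>c snd k)" if "finite A" for A
    using that
  proof induction
    case empty
    then show ?case using assms(1)[of 0 0] by simp
  qed (simp add: assms)
  then show ?thesis using x by simp
qed

text \<open>The value is computed on a chosen representative so that the definition is total in
  \<open>\<phi>\<close>. For bilinear \<open>\<phi>\<close> the choice is immaterial, by
  \<open>tensor_lift_abs\<close>.\<close>

definition tensor_lift ::
    "('a::complex_vector \<Rightarrow> 'b::complex_vector \<Rightarrow> 'v::complex_vector) \<Rightarrow> ('a, 'b) tensor \<Rightarrow> 'v" where
  "tensor_lift \<phi> x = free_extend (case_prod \<phi>) (rep_tensor x)"

abbreviation bilinearC :: "('a::complex_vector \<Rightarrow> 'b::complex_vector \<Rightarrow> 'c::complex_vector) \<Rightarrow> bool"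
  where "bilinearC \<equiv> bilinear_over scaleC scaleC scaleC"

lemma linear_scaleC_iff:
  "Vector_Spaces.linear scaleC scaleC f \<longleftrightarrow>
    (\<forall>x y. f (x + y) = f x + f y) \<and> (\<forall>c x. f (c *c x) = c *c f x)"
  for f :: "'a::complex_vector \<Rightarrow> 'b::complex_vector"
  by (auto simp: Vector_Spaces.linear_iff vector_space_pair_def cvec.vector_space_axioms)

lemma bilinearC_iff:
  "bilinearC \<phi> \<longleftrightarrow>
    (\<forall>x y z. \<phi> (x + y) z = \<phi> x z + \<phi> y z) \<and> (\<forall>x y z. \<phi> x (y + z) = \<phi> x y + \<phi> x z) \<and>
    (\<forall>c x y. \<phi> (c *c x) y = c *c \<phi> x y) \<and> (\<forall>c x y. \<phi> x (c *c y) = c *c \<phi> x y)"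
  unfolding bilinear_over_def linear_scaleC_iff by blast

text \<open>Bilinearity of \<open>\<phi>\<close> makes its linear extension vanish on each relator,
  and its kernel is a subspace.\<close>

lemma free_extend_span_relators:
  assumes "bilinearC \<phi>" and "r \<in> cvec.span tensor_relators"
  shows "free_extend (case_prod \<phi>) r = 0"
proof -
  interpret F: Vector_Spaces.linear scaleC scaleC "free_extend (case_prod \<phi>)"
    by (rule linear_free_extend)
  show ?thesis
    using assms(2)
  proof (rule F.eq_0_on_span[rotated])
    fix r assume "r \<in> (tensor_relators :: ('a \<times> 'b \<Rightarrow>\<^sub>0 complex) set)"
    then show "free_extend (case_prod \<phi>) r = 0"
      using assms(1) unfolding tensor_relators_def bilinearC_iff
      by (auto simp: F.diff F.scale free_extend_single)
  qed
qed

lemma tensor_lift_abs: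
  assumes "bilinearC \<phi>"
  shows "tensor_lift \<phi> (abs_tensor r) = free_extend (case_prod \<phi>) r"
proof -
  interpret F: Vector_Spaces.linear scaleC scaleC "free_extend (case_prod \<phi>)"
    by (rule linear_free_extend)
  have "rep_tensor (abs_tensor r) - r \<in> cvec.span tensor_relators"
    by (metis (no_types, lifting) Quotient3_rep_abs Quotient3_tensor cvec.span_zero diff_self)
  from free_extend_span_relators[OF assms this] show ?thesis
    by (simp add: tensor_lift_def F.diff)
qed

lemma tensor_lift_tensor: "bilinearC \<phi> \<Longrightarrow> tensor_lift \<phi> (a \<otimes>\<^sub>c b) = \<phi> a b"
  by (simp add: tensor.abs_eq tensor_lift_abs free_extend_single)

lemma linear_tensor_lift:
  assumes "bilinearC \<phi>"
  shows "Vector_Spaces.linear scaleC scaleC (tensor_lift \<phi>)"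
proof -
  interpret F: Vector_Spaces.linear scaleC scaleC "free_extend (case_prod \<phi>)"
    by (rule linear_free_extend)
  have "tensor_lift \<phi> (x + y) = tensor_lift \<phi> x + tensor_lift \<phi> y" for x y
    by (induction x rule: tensor.abs_induct, induction y rule: tensor.abs_induct)
      (simp add: plus_tensor.abs_eq tensor_lift_abs[OF assms] F.add)
  moreover have "tensor_lift \<phi> (c *c x) = c *c tensor_lift \<phi> x" for c x
    by (induction x rule: tensor.abs_induct)
      (simp add: scaleC_tensor.abs_eq tensor_lift_abs[OF assms] F.scale)
  ultimately show ?thesis
    by (simp add: linear_scaleC_iff)
qed

text \<open>Applied twice to build the bracket: first to tensors of vectors with Laurent
  polynomials, then to tensors of Laurent series with those.\<close>

lemma tensor_bilinear_extension:
  fixes \<phi> :: "'a::complex_vector \<Rightarrow> 'b::complex_vector \<Rightarrow> 'c::complex_vector \<Rightarrow> 'd::complex_vector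
    \<Rightarrow> 'v::complex_vector"
  assumes L: "\<And>c d. bilinearC (\<lambda>a b. \<phi> a b c d)" and R: "\<And>a b. bilinearC (\<phi> a b)"
  obtains B where "bilinearC B" "\<And>a b c d. B (a \<otimes>\<^sub>c b) (c \<otimes>\<^sub>c d) = \<phi> a b c d"
proof
  let ?B = "\<lambda>x y. tensor_lift (\<lambda>a b. tensor_lift (\<phi> a b) y) x"
  note Rl = linear_tensor_lift[OF R, unfolded linear_scaleC_iff]
  have b: "bilinearC (\<lambda>a b. tensor_lift (\<phi> a b) y)" for y
  proof (induction y rule: tensor_induct)
    case (tensor c d)
    then show ?case by (simp add: tensor_lift_tensor R L)
  next
    case (add x y)
    then show ?case by (simp add: bilinearC_iff Rl scaleC_add_right)
  qed
  note bl = linear_tensor_lift[OF b, unfolded linear_scaleC_iff]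
  show B: "?B (a \<otimes>\<^sub>c b) (c \<otimes>\<^sub>c d) = \<phi> a b c d" for a b c d
    by (simp add: tensor_lift_tensor[OF L] tensor_lift_tensor[OF R])
  \<comment> \<open>The outer lift only gives linearity in \<open>x\<close>. Linearity in
    \<open>y\<close> holds for pure \<open>x\<close>, where the inner lift is exposed, and passes to
    sums.\<close>
  have "?B x (y + z) = ?B x y + ?B x z" for x y z
  proof (induction x rule: tensor_induct)
    case (tensor a b)
    have "?B (a \<otimes>\<^sub>c b) (y + z) = tensor_lift (\<phi> a b) (y + z)"
      by (rule tensor_lift_tensor[OF b])
    then show ?case by (simp only: tensor_lift_tensor[OF b] Rl)
  next
    case (add x x')
    then show ?case by (simp only: bl ac_simps)
  qed
  moreover have "?B x (c *c y) = c *c ?B x y" for x y c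
  proof (induction x rule: tensor_induct)
    case (tensor a b)
    have "?B (a \<otimes>\<^sub>c b) (c *c y) = tensor_lift (\<phi> a b) (c *c y)"
      by (rule tensor_lift_tensor[OF b])
    then show ?case by (simp only: tensor_lift_tensor[OF b] Rl)
  next
    case (add x x')
    then show ?case by (simp only: bl scaleC_add_right)
  qed
  ultimately show "bilinearC ?B"
    by (simp add: bilinearC_iff bl)
qed

lemma bilinearC_free_extend:
  assumes "\<And>k. bilinearC (\<lambda>u v. \<phi> u v k)"
  shows "bilinearC (\<lambda>u v. free_extend (\<phi> u v) P)"
  using assms unfolding bilinearC_iff free_extend_def
  by (simp add: scaleC_add_right sum.distrib cvec.scale_sum_right scaleC_scaleC mult.commute)

lemma laurent_poly_induct [case_names t_pow add scale]:
  assumes "\<And>n. P (t_pow n)" "\<And>x y. P x \<Longrightarrow> P y \<Longrightarrow> P (x + y)" "\<And>c x. P x \<Longrightarrow> P (c *c x)"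
  shows "P x"
proof -
  have "P (\<Sum>k\<in>A. Poly_Mapping.lookup x k *c t_pow k)" if "finite A" for A
    using that
  proof induction
    case empty
    then show ?case using assms(3)[OF assms(1), of 0 0] by simp
  qed (simp add: assms)
  from this[of "Poly_Mapping.keys x"] free_extend_single_id[of x] show ?thesis
    by (simp add: free_extend_def t_pow_def)
qed

section \<open>The vector space structure over C((z))\<close>

lemma linear_fls_scale:
  "Vector_Spaces.linear scaleC scaleC (fls_scale f :: (complex fls, 'b::complex_vector) tensor \<Rightarrow> _)"
proof -
  note F = linear_free_extend[unfolded linear_scaleC_iff]
  have "fls_scale f (x + y) = fls_scale f x + fls_scale f y" for x y :: "(complex fls, 'b) tensor"
    by transfer (simp add: F cvec.span_zero)
  moreover have "fls_scale f (c *c x) = c *c fls_scale f x" for c and x :: "(complex fls, 'b) tensor"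
    by transfer (simp add: F cvec.span_zero)
  ultimately show ?thesis
    by (simp add: linear_scaleC_iff)
qed

lemmas fls_scale_add_right = linear_fls_scale[unfolded linear_scaleC_iff, THEN conjunct1, rule_format]

lemma fls_scale_add_left: "fls_scale (f + g) x = fls_scale f x + fls_scale g x"
  by (induction x rule: tensor_induct)
    (simp_all add: fls_scale_tensor fls_scale_add_right tensor_add_left distrib_right)

lemma fls_scale_fls_scale: "fls_scale f (fls_scale g x) = fls_scale (f * g) x"
  by (induction x rule: tensor_induct) (simp_all add: fls_scale_tensor fls_scale_add_right mult.assoc)

lemma fls_scale_one: "fls_scale 1 x = x"
  by (induction x rule: tensor_induct) (simp_all add: fls_scale_tensor fls_scale_add_right)

lemma fls_scale_const: "fls_scale (fls_const c) x = c *c x"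
  by (induction x rule: tensor_induct)
    (simp_all add: fls_scale_tensor fls_scale_add_right scaleC_add_right tensor_scaleC_left
      flip: scaleC_fls_eq)

section \<open>The underlying space and the prescribed distributions\<close>

interpretation check: vector_space check_scale
  by unfold_locales
    (simp_all add: check_scale_def fls_scale_add_right fls_scale_add_left fls_scale_fls_scale
      fls_scale_one distrib_left distrib_right mult.assoc)

lemma check_scaleC_eq: "check_scaleC = scaleC"
  by (intro ext)
    (simp add: check_scaleC_def check_scale_def fls_scale_const scaleC_prod_def scaleC_fls_eq)

lemma check_scale_tensor: "check_scale f (g \<otimes>\<^sub>c w, h) = ((f * g) \<otimes>\<^sub>c w, f * h)"
  by (simp add: check_scale_def fls_scale_tensor)

lemma scaleC_check_space: "c *c x = check_scale (fls_const c) x"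
  for x :: "('g::complex_vector, 'h::complex_vector) check_space"
  by (simp add: check_scaleC_def flip: check_scaleC_eq)

lemma check_elem_eq: "check_elem f u n = check_scale f (check_elem 1 u n)"
  by (simp add: check_elem_def check_scale_tensor)

lemma check_elem_add: "check_elem f (u + v) n = check_elem f u n + check_elem f v n"
  by (simp add: check_elem_def tensor_add_left tensor_add_right)

lemma check_elem_scaleC: "check_elem f (c *c u) n = check_scale (fls_const c) (check_elem f u n)"
  by (simp add: check_elem_def tensor_scaleC_left tensor_scaleC_right check_scale_tensor
      flip: scaleC_fls_eq)

lemma bilinear_check_iff:
  fixes br :: "('g::complex_vector, 'h::complex_vector) check_space \<Rightarrow> _"
  shows "bilinear_over check_scale check_scale check_scale br \<longleftrightarrow>
    (\<forall>x y z. br (x + y) z = br x z + br y z) \<and> (\<forall>x y z. br x (y + z) = br x y + br x z) \<and>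
    (\<forall>f x y. br (check_scale f x) y = check_scale f (br x y)) \<and>
    (\<forall>f x y. br x (check_scale f y) = check_scale f (br x y))"
  unfolding bilinear_over_def
  by (auto simp: Vector_Spaces.linear_iff vector_space_pair_def check.vector_space_axioms)

section \<open>Coefficients of p(z + x) and their derivatives\<close>

lemma poly_shift_pCons: "poly_shift (pCons a p) = [:fls_const a:] + [:fls_X, 1:] * poly_shift p"
  by (simp add: poly_shift_def map_poly_pCons pcompose_pCons)

lemma poly_shift_0: "poly_shift 0 = 0"
  by (simp add: poly_shift_def)

lemma poly_shift_pderiv: "poly_shift (pderiv p) = pderiv (poly_shift p)"
proof -
  have "map_poly fls_const (pderiv p) = pderiv (map_poly fls_const p)"
    by (rule poly_eqI) (simp add: coeff_pderiv coeff_map_poly fls_of_nat del: of_nat_Suc)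
  then show ?thesis
    by (simp add: poly_shift_def pderiv_pcompose pderiv_pCons)
qed

text \<open>The derivatives of p(z + x) in z and in x agree; this compares their coefficients at
  x^k. The induction follows the Horner recursion a + (z + x) q(z + x).\<close>

lemma fls_deriv_coeff_poly_shift:
  "fls_deriv (coeff (poly_shift p) k) = of_nat (Suc k) * coeff (poly_shift p) (Suc k)"
proof (induction p arbitrary: k)
  case 0
  then show ?case by (simp add: poly_shift_0)
next
  case (pCons a p)
  show ?case
    by (cases k) (simp_all add: poly_shift_pCons pCons.IH algebra_simps)
qed

text \<open>The coefficient of \<open>x\<^sup>-\<^sup>s\<close>, in the sign convention natural for indices \<open>s = m + n\<close> of modes.\<close>

definition shift_coeff :: "complex poly \<Rightarrow> int \<Rightarrow> complex fls" where
  "shift_coeff p s = (if s \<le> 0 then coeff (poly_shift p) (nat (- s)) else 0)"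

text \<open>At most the term with k = -s survives. If -s exceeds the degree, the sum is empty of
  such terms, but the coefficient is zero as well.\<close>

lemma sum_shift_coeff:
  "(\<Sum>k\<le>degree (poly_shift p).
      check_scale (coeff (poly_shift p) k) (if s + int k = 0 then x else 0))
    = check_scale (shift_coeff p s) x"
proof (cases "s \<le> 0")
  case True
  then have *: "s + int k = 0 \<longleftrightarrow> k = nat (- s)" for k
    by auto
  have "(\<Sum>k\<le>degree (poly_shift p).
      check_scale (coeff (poly_shift p) k) (if s + int k = 0 then x else 0))
    = (\<Sum>k\<le>degree (poly_shift p).
      if k = nat (- s) then check_scale (coeff (poly_shift p) k) x else 0)"
    by (intro sum.cong) (simp_all add: *)
  then show ?thesis
    using True by (simp add: shift_coeff_def coeff_eq_0)
next
  case False
  then have "s + int k \<noteq> 0" for k by auto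
  then show ?thesis
    using False by (simp add: shift_coeff_def)
qed

lemma shift_coeff_pderiv: "shift_coeff (pderiv p) (s + 1) = - of_int s * shift_coeff p s"
proof (cases "s < 0")
  case True
  define k where "k = nat (- s) - 1"
  have "s = - int (Suc k)"
    using True by (simp add: k_def)
  then show ?thesis
    by (simp add: shift_coeff_def poly_shift_pderiv coeff_pderiv nat_add_distrib)
qed (auto simp: shift_coeff_def)

lemma fls_deriv_shift_coeff: "fls_deriv (shift_coeff p s) = of_int (1 - s) * shift_coeff p (s - 1)"
proof (cases "s \<le> 0")
  case True
  then obtain k where "s = - int k"
    by (metis nonpos_int_cases)
  then show ?thesis
    by (simp add: shift_coeff_def fls_deriv_coeff_poly_shift nat_add_distrib)
next
  case False
  then show ?thesis
    \<comment> \<open>At s = 1 the constant coefficient on the right may be nonzero, but its factor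
      1 - s vanishes.\<close>
    by (cases "s = 1") (auto simp: shift_coeff_def)
qed

section \<open>Coefficients of the prescribed distributions\<close>

lemma dist_mult_delta: "dist_mult (gen_field u) delta_dist i j = check_elem 1 u (- i - j - 2)"
proof -
  \<comment> \<open>The delta distribution pairs x1^i only with x2^(-i-1), so the field must supply
    x2^(i+j+1), whose mode is -i-j-2.\<close>
  have *: "check_scale (delta_dist i (j - k)) (gen_field u k) =
    (if k = i + j + 1 then gen_field u k else 0)" for k
    by (auto simp: delta_dist_def)
  show ?thesis
    unfolding dist_mult_def *
    by (subst Sum_any.expand_superset[of "{i + j + 1}"]) (auto simp: gen_field_def algebra_simps)
qed

lemma central_dist_delta: "central_dist delta_dist i j = (if i + j + 1 = 0 then check_central else 0)"
  by (auto simp: central_dist_def delta_dist_def)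

lemma central_dist_deriv_delta:
  "central_dist (deriv_x2 delta_dist) i j =
    (if i + j + 2 = 0 then check_scale (- of_int (i + 1)) check_central else 0)"
proof (cases "j = - i - 2")
  case True
  then show ?thesis
    by (simp add: central_dist_def delta_dist_def deriv_x2_def)
next
  case False
  then have "j + 1 \<noteq> - i - 1" "i + j + 2 \<noteq> 0" by simp_all
  then show ?thesis
    by (simp add: central_dist_def delta_dist_def deriv_x2_def)
qed

lemma poly_x2_mult_central_delta:
  "poly_x2_mult (poly_shift q) (central_dist delta_dist) i j
    = check_scale (shift_coeff q (- i - j - 1)) check_central"
proof -
  have "(i + (j - int k) + 1 = 0) = (- i - j - 1 + int k = 0)" for k
    by auto
  then show ?thesis
    by (simp only: poly_x2_mult_def central_dist_delta sum_shift_coeff)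
qed

lemma poly_x2_mult_central_deriv_delta:
  "poly_x2_mult (poly_shift q) (central_dist (deriv_x2 delta_dist)) i j
    = check_scale (- of_int (i + 1) * shift_coeff q (- i - j - 2)) check_central"
proof -
  have "(i + (j - int k) + 2 = 0) = (- i - j - 2 + int k = 0)" for k
    by auto
  then show ?thesis
    by (simp only: poly_x2_mult_def central_dist_deriv_delta sum_shift_coeff check.scale_scale
        mult.commute)
qed

lemma fls_const_half: "fls_const (1/2 * c) = fls_const c / 2" for c :: complex
proof -
  have "2 * fls_const (1/2 * c) = fls_const c"
    using fls_const_mult_const[of 2 "1/2 * c"] by simp
  then show ?thesis by (simp add: field_simps)
qed

section \<open>The bracket on generators\<close>

locale check_bracket_data = L: metric_lie_algebra scaleC lie form
  for lie :: "'g::complex_vector \<Rightarrow> 'g \<Rightarrow> 'g" and form :: "'g \<Rightarrow> 'g \<Rightarrow> complex" +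
  fixes up :: "'g \<Rightarrow> 'h::complex_vector" and p :: "complex poly"
  assumes linear_up: "Vector_Spaces.linear scaleC scaleC up" and bij_up: "bij up"
begin

abbreviation down :: "'h \<Rightarrow> 'g" where "down \<equiv> inv up"

lemma up_down [simp]: "up (down h) = h"
  using bij_up by (simp add: bij_is_surj surj_f_inv_f)

lemma up_add: "up (a + b) = up a + up b" and up_scale: "up (c *c a) = c *c up a"
  using linear_up by (simp_all add: linear_scaleC_iff)

lemma down_add: "down (h + k) = down h + down k" and down_scale: "down (c *c h) = c *c down h"
proof -
  note inj = injD[OF bij_is_inj[OF bij_up]]
  show "down (h + k) = down h + down k"
    by (rule inj) (simp add: up_add)
  show "down (c *c h) = c *c down h"
    by (rule inj) (simp add: up_scale)
qed

lemma lie_bilinear: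
  "lie (a + b) c = lie a c + lie b c" "lie a (b + c) = lie a b + lie a c"
  "lie (s *c a) b = s *c lie a b" "lie a (s *c b) = s *c lie a b"
  using L.bilinear unfolding bilinearC_iff by auto

lemma form_bilinear:
  "form (a + b) c = form a c + form b c" "form a (b + c) = form a b + form a c"
  "form (s *c a) b = s * form a b" "form a (s *c b) = s * form a b"
proof -
  have "scaleC = ((*) :: complex \<Rightarrow> _)"
    by (intro ext) (simp add: scaleC_complex_def)
  then have "bilinearC form"
    using L.form_bilinear by simp
  then show "form (a + b) c = form a c + form b c" "form a (b + c) = form a b + form a c"
  "form (s *c a) b = s * form a b" "form a (s *c b) = s * form a b"
    unfolding bilinearC_iff by (auto simp: scaleC_complex_def)
qed

lemma lie_skew: "lie b a = - lie a b"
proof -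
  have "lie a b + lie b a = 0"
    using L.alternating[of "a + b"] unfolding lie_bilinear by (simp add: L.alternating add.commute)
  then show ?thesis
    by (simp add: eq_neg_iff_add_eq_0 add.commute)
qed

lemma form_lie_cyclic: "form b (lie c a) = form a (lie b c)"
  by (metis L.form_invariant L.form_symmetric)

text \<open>
  The flag marks the factor \<open>w\<close>: \<open>gen False a n\<close> is \<open>a \<otimes> t\<^sup>n\<close> and \<open>gen True a n\<close> is \<open>a\<^sup>1 \<otimes> t\<^sup>n\<close>, while
  \<open>poly_gen\<close> carries the additional factor \<open>p(z + t)\<close>.
\<close>

definition gen :: "bool \<Rightarrow> 'g \<Rightarrow> int \<Rightarrow> ('g, 'h) check_space" where
  "gen s a n = check_elem 1 (if s then (0, up a) else (a, 0)) n"

definition poly_gen :: "bool \<Rightarrow> 'g \<Rightarrow> int \<Rightarrow> ('g, 'h) check_space" where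
  "poly_gen s a n =
    (\<Sum>k\<le>degree (poly_shift p). check_scale (coeff (poly_shift p) k) (gen s a (n + int k)))"

definition cocycle :: "bool \<Rightarrow> int \<Rightarrow> bool \<Rightarrow> int \<Rightarrow> complex fls" where
  "cocycle s m r n =
    (if s \<and> r then of_int (m - n) / 2 * shift_coeff p (m + n)
     else if s \<or> r \<or> m + n \<noteq> 0 then 0 else of_int m)"

text \<open>The product of two factors w is p(z + t), which is why two set flags give
  \<open>poly_gen False\<close>.\<close>

definition gen_bracket ::
    "bool \<Rightarrow> 'g \<Rightarrow> int \<Rightarrow> bool \<Rightarrow> 'g \<Rightarrow> int \<Rightarrow> ('g, 'h) check_space" where
  "gen_bracket s a m r b n =
    (if s \<and> r then poly_gen False (lie a b) (m + n) else gen (s \<or> r) (lie a b) (m + n)) +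
    check_scale (fls_const (form a b) * cocycle s m r n) check_central"

lemma gen_add: "gen s (a + b) n = gen s a n + gen s b n"
proof -
  have "(if s then (0, up (a + b)) else (a + b, 0)) =
    (if s then (0, up a) else (a, 0)) + (if s then (0, up b) else (b, 0))"
    by (simp add: up_add)
  then show ?thesis
    by (simp add: gen_def check_elem_add del: plus_prod_def)
qed

lemma gen_scale: "gen s (c *c a) n = check_scale (fls_const c) (gen s a n)"
proof -
  have "(if s then (0, up (c *c a)) else (c *c a, 0)) =
    c *c (if s then (0, up a) else (a, 0))"
    by (simp add: up_scale scaleC_prod_def)
  then show ?thesis
    by (simp only: gen_def check_elem_scaleC)
qed

lemma gen_zero: "gen s 0 n = 0"
  using gen_scale[of s 0 0 n] by simp

lemma gen_minus: "gen s (- a) n = - gen s a n"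
  using gen_add[of s a "- a" n] by (simp add: gen_zero eq_neg_iff_add_eq_0 add.commute)

lemma poly_gen_add: "poly_gen s (a + b) n = poly_gen s a n + poly_gen s b n"
  by (simp add: poly_gen_def gen_add check.scale_right_distrib sum.distrib)

lemma poly_gen_scale: "poly_gen s (c *c a) n = check_scale (fls_const c) (poly_gen s a n)"
  by (simp add: poly_gen_def gen_scale check.scale_sum_right mult.commute)

lemma poly_gen_zero: "poly_gen s 0 n = 0"
  by (simp add: poly_gen_def gen_zero)

lemma poly_gen_minus: "poly_gen s (- a) n = - poly_gen s a n"
  by (simp add: poly_gen_def gen_minus sum_negf)

lemma gen_bracket_bilinear:
  "gen_bracket s (a + b) m r c n = gen_bracket s a m r c n + gen_bracket s b m r c n"
  "gen_bracket s a m r (b + c) n = gen_bracket s a m r b n + gen_bracket s a m r c n"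
  "gen_bracket s (z *c a) m r b n = check_scale (fls_const z) (gen_bracket s a m r b n)"
  "gen_bracket s a m r (z *c b) n = check_scale (fls_const z) (gen_bracket s a m r b n)"
  by (simp_all add: gen_bracket_def lie_bilinear form_bilinear gen_add gen_scale poly_gen_add
      poly_gen_scale check.scale_left_distrib check.scale_right_distrib distrib_right mult.assoc
      flip: fls_plus_const fls_const_mult_const)

lemma check_elem_gen:
  "check_elem f u n = check_scale f (gen False (fst u) n) + check_scale f (gen True (down (snd u)) n)"
proof -
  have "u = (fst u, 0) + (0, snd u)" by simp
  then have "check_elem f u n = check_elem f (fst u, 0) n + check_elem f (0, snd u) n"
    by (metis check_elem_add)
  then show ?thesis
    by (simp add: gen_def flip: check_elem_eq)
qed

text \<open>Complex coefficients of Laurent polynomials move into \<open>f\<close>, so these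
  multiples generate the space additively. Without a case for scalars, the induction also suits maps
  such as D that are not linear over C((z)).\<close>

lemma gen_induct [case_names gen central add]:
  assumes gen: "\<And>f s a n. P (check_scale f (gen s a n))"
    and central: "\<And>f. P (check_scale f check_central)"
    and add: "\<And>x y. P x \<Longrightarrow> P y \<Longrightarrow> P (x + y)"
  shows "P x"
proof -
  have pure: "P (f \<otimes>\<^sub>c w, 0)" for f w
  proof (induction w arbitrary: f rule: tensor_induct)
    case (tensor u q)
    show ?case
    proof (induction q arbitrary: f rule: laurent_poly_induct)
      case (t_pow n)
      have "(f \<otimes>\<^sub>c u \<otimes>\<^sub>c t_pow n, 0) = check_elem f u n"
        by (simp add: check_elem_def)
      then show ?case
        by (simp add: check_elem_gen gen add)
    next
      case (add q r)
      then show ?case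
        using assms(3)[OF add.IH(1)[of f] add.IH(2)[of f]] by (simp add: tensor_add_right)
    next
      case (scale c q)
      then show ?case
        using scale.IH[of "c *c f"] by (simp add: tensor_scaleC_right tensor_scaleC_left)
    qed
  next
    case (add v w)
    then show ?case
      using assms(3)[OF add.IH(1)[of f] add.IH(2)[of f]] by (simp add: tensor_add_right)
  qed
  have "P (w, 0)" for w
  proof (induction w rule: tensor_induct)
    case (add v w)
    then show ?case using assms(3) by fastforce
  qed (rule pure)
  moreover have "P (0, g)" for g
  proof -
    have "(0, g) = check_scale g (check_central :: ('g, 'h) check_space)"
      using fls_scale_add_right[of g 0 0] by (simp add: check_scale_def check_central_def)
    then show ?thesis using central[of g] by (simp only:)
  qed
  moreover have "x = (fst x, 0) + (0, snd x)" by simp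
  ultimately show ?thesis by (metis add)
qed

text \<open>Comparing coefficients of x1^i x2^j turns the four equations of distributions into one
  formula for the modes m = -i-1 and n = -j-1.\<close>

lemma is_check_bracket_iff:
  "is_check_bracket lie form up p br \<longleftrightarrow>
    bilinear_over check_scale check_scale check_scale br \<and>
    (\<forall>x. br check_central x = 0 \<and> br x check_central = 0) \<and>
    (\<forall>s a m r b n. br (gen s a m) (gen r b n) = gen_bracket s a m r b n)"
proof -
  have index: "(\<forall>i j. Q (- i - 1) (- j - 1)) \<longleftrightarrow> (\<forall>m n. Q m n)" for Q :: "int \<Rightarrow> int \<Rightarrow> bool"
  proof safe
    fix m n assume *: "\<forall>i j. Q (- i - 1) (- j - 1)"
    show "Q m n" using *[rule_format, of "- m - 1" "- n - 1"] by simp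
  qed simp
  have poly: "poly_x2_mult (poly_shift p) (dist_mult (gen_field (a, 0)) delta_dist) i j
    = poly_gen False a (- i - j - 2)" for a i j
    unfolding poly_x2_mult_def poly_gen_def dist_mult_delta gen_def
    by (intro sum.cong) (auto simp: algebra_simps)
  have FF: "(dist_mult (gen_field (lie a b, 0)) delta_dist
      \<oplus>\<^sub>d dist_smult (form a b) (central_dist (deriv_x2 delta_dist))) i j
      = gen_bracket False a (- i - 1) False b (- j - 1)" for a b i j
    proof (cases "i + j + 2 = 0")
    case True
    then have "j = - i - 2" by simp
    then show ?thesis
      by (simp add: dist_add_def dist_smult_def check_scaleC_def dist_mult_delta
          central_dist_deriv_delta gen_bracket_def cocycle_def gen_def)
  next
    case False
    then have "(- i - 1) + (- j - 1) \<noteq> 0" by simp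
    with False show ?thesis
      unfolding dist_add_def dist_smult_def check_scaleC_def dist_mult_delta
        central_dist_deriv_delta gen_bracket_def cocycle_def gen_def
      by (simp add: algebra_simps)
  qed
  have FT: "dist_mult (gen_field (0, up (lie a b))) delta_dist i j
      = gen_bracket False a (- i - 1) True b (- j - 1)" for a b i j
    by (simp add: dist_mult_delta gen_bracket_def cocycle_def gen_def)
  \<comment> \<open>Both mixed equations have the same right-hand side, which \<open>FT\<close>
    expresses with the flags \<open>False\<close>, \<open>True\<close>.\<close>
  have TF: "gen_bracket True a m False b n = gen_bracket False a m True b n" for a b m n
    by (simp add: gen_bracket_def cocycle_def)
  \<comment> \<open>With s = m + n, the term in p' contributes -(m + n)/2 and the derivative of
    delta contributes m. Together they give the factor (m - n)/2.\<close>
  have coc: "shift_coeff (pderiv p) (- i - j - 1) / 2 - of_int (i + 1) * shift_coeff p (- i - j - 2)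
      = cocycle True (- i - 1) True (- j - 1)" for i j
  proof -
    define s where "s = - i - j - 2"
    have s: "- i - j - 1 = s + 1" "- i - j - 2 = s" "(- i - 1) + (- j - 1) = s"
      by (simp_all add: s_def)
    have i: "i = - s - j - 2"
      by (simp add: s_def)
    show ?thesis
      unfolding s cocycle_def shift_coeff_pderiv unfolding i by (simp add: field_simps)
  qed
  have TT: "(poly_x2_mult (poly_shift p) (dist_mult (gen_field (lie a b, 0)) delta_dist)
          \<oplus>\<^sub>d dist_smult (1/2 * form a b)
                (poly_x2_mult (poly_shift (pderiv p)) (central_dist delta_dist))
          \<oplus>\<^sub>d dist_smult (form a b)
                (poly_x2_mult (poly_shift p) (central_dist (deriv_x2 delta_dist)))) i j
      = gen_bracket True a (- i - 1) True b (- j - 1)" for a b i j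
  proof -
    have "(- i - 1) + (- j - 1) = - i - j - 2" by simp
    then show ?thesis
      unfolding gen_bracket_def coc[symmetric] dist_add_def dist_smult_def check_scaleC_def
        poly poly_x2_mult_central_delta poly_x2_mult_central_deriv_delta fls_const_half
      by (simp add: algebra_simps check.scale_left_distrib check.scale_left_diff_distrib)
  qed
  have gen_field: "gen_field (a, 0) i = gen False a (- i - 1)"
    "gen_field (0, up a) i = gen True a (- i - 1)" for a i
    by (simp_all add: gen_field_def gen_def)
  have split: "(\<forall>s a m r b n. Q s a m r b n) \<longleftrightarrow>
    (\<forall>a b. (\<forall>m n. Q False a m False b n) \<and> (\<forall>m n. Q False a m True b n) \<and>
      (\<forall>m n. Q True a m False b n) \<and> (\<forall>m n. Q True a m True b n))"
    for Q :: "bool \<Rightarrow> 'g \<Rightarrow> int \<Rightarrow> bool \<Rightarrow> 'g \<Rightarrow> int \<Rightarrow> bool"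
    by (auto simp: all_bool_eq)
  show ?thesis
    unfolding is_check_bracket_def bracket_dist_def fun_eq_iff gen_field FF FT TT
      split[of "\<lambda>s a m r b n. br (gen s a m) (gen r b n) = gen_bracket s a m r b n"] TF
      index[of "\<lambda>m n. br (gen s a m) (gen r b n) = gen_bracket s' a m r' b n" for s r s' r' a b]
    by (rule refl)
qed

section \<open>Existence of the bracket\<close>

definition t_bracket :: "'g \<times> 'h \<Rightarrow> 'g \<times> 'h \<Rightarrow> int \<Rightarrow> int \<Rightarrow> ('g, 'h) check_space" where
  "t_bracket u v m n =
    gen_bracket False (fst u) m False (fst v) n +
    gen_bracket False (fst u) m True (down (snd v)) n +
    gen_bracket True (down (snd u)) m False (fst v) n +
    gen_bracket True (down (snd u)) m True (down (snd v)) n"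

lemma bilinear_t_bracket: "bilinearC (\<lambda>u v. t_bracket u v m n)"
  unfolding bilinearC_iff t_bracket_def scaleC_check_space
  by (simp add: gen_bracket_bilinear down_add down_scale scaleC_prod_def check.scale_right_distrib
      ac_simps)

lemma down_zero: "down 0 = 0"
  using down_scale[of 0 0] by simp

lemma gen_bracket_zero: "gen_bracket s 0 m r b n = 0" "gen_bracket s a m r 0 n = 0"
  using gen_bracket_bilinear(3)[of s 0 0 m r b n] gen_bracket_bilinear(4)[of s a m r 0 0 n] by simp_all

lemma t_bracket_gen:
  "t_bracket (if s then (0, up a) else (a, 0)) (if r then (0, up b) else (b, 0)) m n
    = gen_bracket s a m r b n"
  using bij_up
  by (cases s; cases r) (simp_all add: t_bracket_def down_zero gen_bracket_zero bij_is_inj inv_f_f)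

text \<open>The values on modes are extended to Laurent polynomials, then to the inner and finally
  to the outer tensor product.\<close>

lemma ex_check_bracket: "\<exists>br. is_check_bracket lie form up p br"
proof -
  define \<beta>0 where "\<beta>0 u P v Q = free_extend (\<lambda>m. free_extend (t_bracket u v m) Q) P" for u P v Q
  note free_linear = linear_free_extend[unfolded linear_scaleC_iff]
  have uv: "bilinearC (\<lambda>u v. \<beta>0 u P v Q)" for P Q
    unfolding \<beta>0_def by (intro bilinearC_free_extend bilinear_t_bracket)
  have PQ: "bilinearC (\<lambda>P Q. \<beta>0 u P v Q)" for u v
    unfolding \<beta>0_def bilinearC_iff
    by (simp add: free_linear)
      (simp add: free_extend_def scaleC_add_right sum.distrib cvec.scale_sum_right scaleC_scaleC
        ac_simps)
  \<comment> \<open>Linearity in each of the four arguments is regrouped into the pairs that form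
    the tensors.\<close>
  have "bilinearC (\<beta>0 u P)" "bilinearC (\<lambda>u P. \<beta>0 u P v Q)" for u P v Q
    unfolding bilinearC_iff
    by (simp_all add: uv[unfolded bilinearC_iff] PQ[unfolded bilinearC_iff])
  then obtain \<beta> where \<beta>: "bilinearC \<beta>" "\<And>u P v Q. \<beta> (u \<otimes>\<^sub>c P) (v \<otimes>\<^sub>c Q) = \<beta>0 u P v Q"
    using tensor_bilinear_extension[of \<beta>0] by blast
  note \<beta>l = \<beta>(1)[unfolded bilinearC_iff]
  have scale_mult: "(c *c f) * g = c *c (f * g)" "f * c *c g = c *c (f * g)"
    for c and f g :: "complex fls"
    by (simp_all add: scaleC_fls_eq ac_simps)
  have "bilinearC (\<lambda>g y. check_scale (f * g) (\<beta> x y))"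
    "bilinearC (\<lambda>f x. check_scale (f * g) (\<beta> x y))" for f x g y
    unfolding bilinearC_iff
    by (simp_all add: \<beta>l check.scale_left_distrib check.scale_right_distrib distrib_left distrib_right
        scale_mult scaleC_check_space[where x="_ :: ('g, 'h) check_space"] scaleC_fls_eq ac_simps)
  then obtain B where B: "bilinearC B"
    "\<And>f x g y. B (f \<otimes>\<^sub>c x) (g \<otimes>\<^sub>c y) = check_scale (f * g) (\<beta> x y)"
    using tensor_bilinear_extension[of "\<lambda>f x g y. check_scale (f * g) (\<beta> x y)"] by blast
  note Bl = B(1)[unfolded bilinearC_iff]
  have Bz: "B 0 y = 0" "B x 0 = 0" for x y
    using Bl by (metis cvec.scale_zero_left)+
  have scale: "B (fls_scale h x) y = check_scale h (B x y)"
    "B x (fls_scale h y) = check_scale h (B x y)"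
    for h x y
  proof -
    have "B (fls_scale h x) y = check_scale h (B x y) \<and> B x (fls_scale h y) = check_scale h (B x y)"
    proof (induction x rule: tensor_induct)
      case (tensor f v)
      show ?case
        by (induction y rule: tensor_induct)
          (simp_all add: B(2) Bl fls_scale_tensor fls_scale_add_right check.scale_right_distrib ac_simps)
    qed (simp add: Bl fls_scale_add_right check.scale_right_distrib)
    then show "B (fls_scale h x) y = check_scale h (B x y)"
      "B x (fls_scale h y) = check_scale h (B x y)"
      by auto
  qed
  have gen: "B (fst (gen s a m)) (fst (gen r b n)) = gen_bracket s a m r b n" for s a m r b n
    unfolding gen_def check_elem_def fst_conv B(2) \<beta>(2) \<beta>0_def t_pow_def free_extend_single
      t_bracket_gen
    by simp
  \<comment> \<open>Ignoring the second components of the arguments makes the element k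
    central.\<close>
  have "is_check_bracket lie form up p (\<lambda>x y. B (fst x) (fst y))"
    unfolding is_check_bracket_iff bilinear_check_iff
    by (simp add: Bl scale gen check_scale_def check_central_def Bz)
  then show ?thesis by blast
qed

end

section \<open>The Lie algebra axioms\<close>

locale check_bracket = check_bracket_data lie form up p
  for lie :: "'g::complex_vector \<Rightarrow> 'g \<Rightarrow> 'g" and form :: "'g \<Rightarrow> 'g \<Rightarrow> complex"
    and up :: "'g \<Rightarrow> 'h::complex_vector" and p :: "complex poly" +
  fixes br :: "('g, 'h) check_space \<Rightarrow> ('g, 'h) check_space \<Rightarrow> ('g, 'h) check_space"
  assumes is_check_bracket: "is_check_bracket lie form up p br"
begin

lemma bracket_linear:
  "br (x + y) z = br x z + br y z" "br x (y + z) = br x y + br x z"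
  "br (check_scale f x) y = check_scale f (br x y)" "br x (check_scale f y) = check_scale f (br x y)"
  using is_check_bracket unfolding is_check_bracket_iff bilinear_check_iff by blast+

lemma bracket_central: "br check_central x = 0" "br x check_central = 0"
  using is_check_bracket unfolding is_check_bracket_iff by blast+

lemma bracket_gen: "br (gen s a m) (gen r b n) = gen_bracket s a m r b n"
  using is_check_bracket unfolding is_check_bracket_iff by blast+

lemma bracket_zero: "br 0 x = 0" "br x 0 = 0"
  using bracket_linear(3)[of 0 0 x] bracket_linear(4)[of x 0 0] by simp_all

lemma bracket_sum: "br x (sum f A) = (\<Sum>k\<in>A. br x (f k))"
  by (induction A rule: infinite_finite_induct) (simp_all add: bracket_zero bracket_linear)

section \<open>Uniqueness and skew symmetry\<close>

lemma bracket_unique: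
  assumes "is_check_bracket lie form up p br'"
  shows "br' = br"
proof (intro ext)
  interpret B: check_bracket lie form up p br'
    by unfold_locales (rule assms)
  fix x y
  show "br' x y = br x y"
  proof (induction x rule: gen_induct)
    case (gen f s a m)
    have "br' (gen s a m) y = br (gen s a m) y"
      by (induction y rule: gen_induct)
        (simp_all add: bracket_linear B.bracket_linear bracket_central B.bracket_central
          bracket_gen B.bracket_gen)
    then show ?case
      by (simp add: bracket_linear B.bracket_linear)
  qed (simp_all add: bracket_linear B.bracket_linear bracket_central B.bracket_central)
qed

lemma gen_bracket_skew: "gen_bracket r b n s a m = - gen_bracket s a m r b n"
proof -
  have "cocycle r n s m = - cocycle s m r n"
  \<comment> \<open>For two clear flags the value is m, supported on m + n = 0, where n = -m gives
    the sign.\<close>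
  proof (cases "m + n = 0")
    case True
    then have "n = - m" by simp
    then show ?thesis by (simp add: cocycle_def)
  qed (auto simp: cocycle_def add.commute field_simps)
  then show ?thesis
    unfolding gen_bracket_def L.form_symmetric[of b a] lie_skew[of b a]
    by (auto simp: gen_minus poly_gen_minus add.commute[of n m])
qed

lemma bracket_skew: "br y x = - br x y"
proof (induction x rule: gen_induct)
  case (gen f s a m)
  have "br y (gen s a m) = - br (gen s a m) y"
  proof (induction y rule: gen_induct)
    case (gen g r b n)
    show ?case
      using gen_bracket_skew[of r b n s a m]
      by (simp add: bracket_linear bracket_gen)
  qed (simp_all add: bracket_linear bracket_central)
  then show ?case
    by (simp add: bracket_linear)
qed (simp_all add: bracket_linear bracket_central)

lemma bracket_alternating: "br x x = 0"
proof -
  have "check_scale 2 (br x x) = br x x + br x x"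
    using check.scale_left_distrib[of 1 1 "br x x"] by simp
  also have "\<dots> = 0"
    using bracket_skew[of x x] by (simp add: eq_neg_iff_add_eq_0)
  finally show ?thesis by simp
qed

section \<open>The Jacobi identity\<close>

lemma bracket_gen_poly_gen:
  "br (gen False a m) (poly_gen False c n) = poly_gen False (lie a c) (m + n) +
    check_scale (fls_const (form a c) * of_int m * shift_coeff p (m + n)) check_central"
  "br (gen True a m) (poly_gen False c n) = poly_gen True (lie a c) (m + n)"
proof -
  \<comment> \<open>The central terms of the sum over k are those of \<open>sum_shift_coeff\<close>,
    so the cocycle of t^m and p(z + t) t^n is m times the coefficient of x^(-m-n) in p(z +
    x).\<close>
  have "br (gen False a m) (poly_gen False c n) =
    (\<Sum>k\<le>degree (poly_shift p).
      check_scale (coeff (poly_shift p) k) (gen False (lie a c) (m + n + int k)) +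
      check_scale (coeff (poly_shift p) k)
        (if m + n + int k = 0 then check_scale (fls_const (form a c) * of_int m) check_central else 0))"
    unfolding poly_gen_def bracket_sum bracket_linear bracket_gen
    by (intro sum.cong refl) (simp add: gen_bracket_def cocycle_def check.scale_right_distrib add.assoc)
  then show "br (gen False a m) (poly_gen False c n) = poly_gen False (lie a c) (m + n) +
    check_scale (fls_const (form a c) * of_int m * shift_coeff p (m + n)) check_central"
    unfolding sum.distrib sum_shift_coeff by (simp add: poly_gen_def mult.commute)
  show "br (gen True a m) (poly_gen False c n) = poly_gen True (lie a c) (m + n)"
    unfolding poly_gen_def bracket_sum bracket_linear bracket_gen
    by (intro sum.cong refl) (simp add: gen_bracket_def cocycle_def add.assoc)
qed

definition jacobiator where
  "jacobiator x y z = br x (br y z) + br y (br z x) + br z (br x y)"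

lemma jacobiator_cyclic: "jacobiator x y z = jacobiator y z x"
  by (simp add: jacobiator_def ac_simps)

lemma jacobiator_linear:
  "jacobiator (x + x') y z = jacobiator x y z + jacobiator x' y z"
  "jacobiator (check_scale f x) y z = check_scale f (jacobiator x y z)"
  "jacobiator check_central y z = 0"
  by (simp_all add: jacobiator_def bracket_linear bracket_central bracket_zero check.scale_right_distrib)

text \<open>All eight parities at once: two or three factors w produce one p(z + t), and a w is left
  over exactly when their number is odd. The scalar is the cocycle of the first factor with the
  product of the other two.\<close>

lemma bracket_bracket_gen:
  "br (gen s a m) (br (gen r b n) (gen q c l)) =
    (if s \<and> r \<or> r \<and> q \<or> q \<and> s then poly_gen (s \<and> r \<and> q) else gen (s \<or> r \<or> q))
      (lie a (lie b c)) (m + n + l) +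
    check_scale (fls_const (form a (lie b c)) *
      (if r \<and> q then if s then 0 else of_int m * shift_coeff p (m + n + l)
       else cocycle s m (r \<or> q) (n + l))) check_central"
  by (cases s; cases r; cases q)
    (simp_all add: bracket_gen gen_bracket_def bracket_linear bracket_central bracket_gen_poly_gen
      cocycle_def add.assoc mult.assoc)

lemma jacobiator_gen: "jacobiator (gen s a m) (gen r b n) (gen q c l) = 0"
proof -
  let ?G = "if s \<and> r \<or> r \<and> q \<or> q \<and> s then poly_gen (s \<and> r \<and> q) else gen (s \<or> r \<or> q)"
  have G: "?G (lie a (lie b c)) N + ?G (lie b (lie c a)) N + ?G (lie c (lie a b)) N = 0" for N
    by (simp add: L.jacobi gen_zero poly_gen_zero flip: gen_add poly_gen_add)
  let ?c = "\<lambda>s m r n q l. if r \<and> q then if s then 0 else of_int m * shift_coeff p (m + n + l)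
    else cocycle s m (r \<or> q) (n + l)"
  \<comment> \<open>Three clear flags give m + n + l on its zero set. If only \<open>s\<close> is
    clear, the factors are m, (n - l - m)/2 and (l - m - n)/2, with sum zero; rotations are alike.
    For an odd number of set flags every term vanishes.\<close>
  have c: "?c s m r n q l + ?c r n q l s m + ?c q l s m r n = 0"
  proof (cases "m + n + l = 0")
    case True
    then have l: "l = - m - n" by simp
    show ?thesis
      unfolding l by (cases s; cases r; cases q) (simp_all add: cocycle_def field_simps)
  next
    case False
    define N where "N = m + n + l"
    have l: "l = N - m - n" by (simp add: N_def)
    show ?thesis
      using False unfolding l
      by (cases s; cases r; cases q) (simp_all add: cocycle_def field_simps)
  qed
  have perm: "n + l + m = m + n + l" "l + m + n = m + n + l"
    "(r \<and> q \<or> q \<and> s \<or> s \<and> r) = (s \<and> r \<or> r \<and> q \<or> q \<and> s)" "(r \<and> q \<and> s) = (s \<and> r \<and> q)"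
    "(r \<or> q \<or> s) = (s \<or> r \<or> q)" "(q \<and> s \<or> s \<and> r \<or> r \<and> q) = (s \<and> r \<or> r \<and> q \<or> q \<and> s)"
    "(q \<and> s \<and> r) = (s \<and> r \<and> q)" "(q \<or> s \<or> r) = (s \<or> r \<or> q)"
    by auto
  have "jacobiator (gen s a m) (gen r b n) (gen q c l) =
    (?G (lie a (lie b c)) (m + n + l) + ?G (lie b (lie c a)) (m + n + l) +
      ?G (lie c (lie a b)) (m + n + l)) +
    check_scale (fls_const (form a (lie b c)) *
      (?c s m r n q l + ?c r n q l s m + ?c q l s m r n)) check_central"
    unfolding jacobiator_def bracket_bracket_gen[of s a m r b n q c l]
      bracket_bracket_gen[of r b n q c l s a m] bracket_bracket_gen[of q c l s a m r b n]
      form_lie_cyclic[of b c a] form_lie_cyclic[of c a b] perm distrib_left check.scale_left_distrib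
    by (simp only: ac_simps)
  then show ?thesis
    unfolding G c by simp
qed

text \<open>Cyclic invariance brings each argument in turn to the first place, the only one where
  linearity has been recorded.\<close>

lemma bracket_jacobi: "jacobiator x y z = 0"
proof -
  have 1: "jacobiator (gen s a m) (gen r b n) z = 0" for s a m r b n
  proof -
    have "jacobiator z (gen s a m) (gen r b n) = 0"
      by (induction z rule: gen_induct) (simp_all add: jacobiator_linear jacobiator_gen)
    then show ?thesis by (simp add: jacobiator_cyclic)
  qed
  have 2: "jacobiator (gen s a m) y z = 0" for s a m
  proof -
    have "jacobiator (gen r b n) z (gen s a m) = 0" for r b n
      using 1[of s a m r b n] by (metis jacobiator_cyclic)
    then have "jacobiator y z (gen s a m) = 0"
      by (induction y rule: gen_induct) (simp_all add: jacobiator_linear)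
    then show ?thesis by (simp add: jacobiator_cyclic[of "gen s a m"])
  qed
  show ?thesis
    by (induction x rule: gen_induct) (simp_all add: jacobiator_linear 2)
qed

lemma lie_algebra_bracket: "lie_algebra check_scale br"
proof unfold_locales
  show "bilinear_over check_scale check_scale check_scale br"
    using is_check_bracket by (simp add: is_check_bracket_def)
qed (use bracket_alternating bracket_jacobi in \<open>auto simp: jacobiator_def\<close>)

end

section \<open>The derivation\<close>

lemma ex_check_D:
  "\<exists>D :: ('g::complex_vector, 'h::complex_vector) check_space \<Rightarrow> ('g, 'h) check_space. is_check_D D"
proof -
  \<comment> \<open>\<open>d\<close> is differentiation in t, and \<open>\<delta>\<close> below
    applies it to the Laurent polynomial factor.\<close>
  define d :: "laurent_poly \<Rightarrow> laurent_poly"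
    where "d = free_extend (\<lambda>n. of_int n *c t_pow (n - 1))"
  note d = linear_free_extend[of "\<lambda>n. of_int n *c t_pow (n - 1)", folded d_def,
      unfolded linear_scaleC_iff]
  define \<delta> :: "('g \<times> 'h, laurent_poly) tensor \<Rightarrow> ('g \<times> 'h, laurent_poly) tensor"
    where "\<delta> = tensor_lift (\<lambda>u P. u \<otimes>\<^sub>c d P)"
  have bilinear_\<delta>: "bilinearC (\<lambda>(u :: 'g \<times> 'h) P. u \<otimes>\<^sub>c d P)"
    unfolding bilinearC_iff
    by (auto simp: d tensor_add_left tensor_add_right tensor_scaleC_left tensor_scaleC_right)
  note \<delta> = linear_tensor_lift[OF bilinear_\<delta>, folded \<delta>_def, unfolded linear_scaleC_iff]
  have \<delta>_tensor: "\<delta> (u \<otimes>\<^sub>c t_pow n) = of_int n *c (u \<otimes>\<^sub>c t_pow (n - 1))" for u n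
    unfolding \<delta>_def tensor_lift_tensor[OF bilinear_\<delta>]
    unfolding t_pow_def d_def free_extend_single by (simp add: tensor_scaleC_right)
  \<comment> \<open>This is the derivative in z minus that in t. It is bilinear over the complex
    numbers, as a lift from the tensor product requires.\<close>
  let ?\<phi> = "\<lambda>(f :: complex fls) w. fls_deriv f \<otimes>\<^sub>c w - f \<otimes>\<^sub>c \<delta> w"
  have deriv_scale: "fls_deriv (c *c f) = c *c fls_deriv f" for c and f :: "complex fls"
    by (simp add: scaleC_fls_eq)
  have bilinear: "bilinearC ?\<phi>"
    unfolding bilinearC_iff
    by (simp add: \<delta> deriv_scale tensor_add_left tensor_add_right tensor_scaleC_left tensor_scaleC_right
        cvec.scale_right_diff_distrib algebra_simps)
  define D :: "('g, 'h) check_space \<Rightarrow> ('g, 'h) check_space"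
    where "D x = (tensor_lift ?\<phi> (fst x), fls_deriv (snd x))" for x
  note lift = linear_tensor_lift[OF bilinear, unfolded linear_scaleC_iff]
  have "tensor_lift ?\<phi> 0 = 0"
    using lift[THEN conjunct2, rule_format, of 0 0] by simp
  moreover have "fls_scale f (0 :: (complex fls, ('g \<times> 'h, laurent_poly) tensor) tensor) = 0" for f
    using fls_scale_add_right[of f 0 0] by simp
  moreover have "f \<otimes>\<^sub>c (of_int n *c w) = (of_int n * f) \<otimes>\<^sub>c w"
    for n and f :: "complex fls" and w :: "('g \<times> 'h, laurent_poly) tensor"
    by (simp add: tensor_scaleC_right scaleC_fls_eq fls_of_int flip: tensor_scaleC_left)
  ultimately have "is_check_D D"
    unfolding is_check_D_def D_def
    by (simp add: additive_def lift check_scale_def check_central_def check_elem_def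
        tensor_lift_tensor[OF bilinear] \<delta>_tensor)
  then show ?thesis by blast
qed

context check_bracket_data
begin

text \<open>The second claim is a product rule over C((z)); on multiples of generators it reduces to
  the one for (f g)'.\<close>

lemma check_D_linear:
  fixes D :: "('g, 'h) check_space \<Rightarrow> ('g, 'h) check_space"
  assumes "is_check_D D"
  shows "D (x + y) = D x + D y"
    "D (check_scale f x) = check_scale (fls_deriv f) x + check_scale f (D x)"
    "D check_central = 0" "D (gen s a n) = - check_scale (of_int n) (gen s a (n - 1))"
proof -
  have add: "D (x + y) = D x + D y" for x y
    using assms unfolding is_check_D_def additive_def by blast
  have scale_central: "D (check_scale f check_central) = check_scale (fls_deriv f) check_central" for f
    using assms by (simp add: is_check_D_def)
  have scale_gen: "D (check_scale f (gen s a n)) =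
    check_scale (fls_deriv f) (gen s a n) - check_scale (of_int n * f) (gen s a (n - 1))" for f s a n
    using assms unfolding is_check_D_def gen_def check_elem_eq[symmetric] by blast
  show gen: "D (gen s a n) = - check_scale (of_int n) (gen s a (n - 1))" for s a n
    using scale_gen[of 1] by simp
  show D_central: "D check_central = 0"
    using scale_central[of 1] by simp
  show "D (check_scale f x) = check_scale (fls_deriv f) x + check_scale f (D x)"
  proof (induction x rule: gen_induct)
    case (gen g s a n)
    show ?case
      using scale_gen[of "f * g" s a n]
      by (simp add: scale_gen check.scale_left_distrib check.scale_right_diff_distrib algebra_simps)
  next
    case (central g)
    show ?case
      using scale_central[of "f * g"] by (simp add: scale_central check.scale_left_distrib algebra_simps)
  qed (simp add: add check.scale_right_distrib)
  show "D (x + y) = D x + D y" by (rule add)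
qed

lemma check_D_unique:
  fixes D D' :: "('g, 'h) check_space \<Rightarrow> ('g, 'h) check_space"
  assumes "is_check_D D" "is_check_D D'"
  shows "D' = D"
proof
  fix x
  show "D' x = D x"
    by (induction x rule: gen_induct)
      (simp_all add: check_D_linear[OF assms(1)] check_D_linear[OF assms(2)])
qed

end

section \<open>The Leibniz rule\<close>

locale check_bracket_derivation = check_bracket lie form up p br
  for lie :: "'g::complex_vector \<Rightarrow> 'g \<Rightarrow> 'g" and form :: "'g \<Rightarrow> 'g \<Rightarrow> complex"
    and up :: "'g \<Rightarrow> 'h::complex_vector" and p :: "complex poly"
    and br :: "('g, 'h) check_space \<Rightarrow> ('g, 'h) check_space \<Rightarrow> ('g, 'h) check_space" +
  fixes D :: "('g, 'h) check_space \<Rightarrow> ('g, 'h) check_space"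
  assumes is_check_D: "is_check_D D"
begin

lemmas D_linear = check_D_linear[OF is_check_D]

lemma D_sum: "D (sum f A) = (\<Sum>k\<in>A. D (f k))"
proof -
  have "D 0 = 0" using D_linear(1)[of 0 0] by simp
  then show ?thesis
    by (induction A rule: infinite_finite_induct) (simp_all add: D_linear)
qed

text \<open>The factor p(z + t) is killed by the derivative in z minus that in t, so only t^n
  contributes.\<close>

lemma D_poly_gen: "D (poly_gen s a n) = - check_scale (of_int n) (poly_gen s a (n - 1))"
proof -
  let ?P = "poly_shift p"
  let ?d = "degree ?P"
  let ?g = "\<lambda>k. check_scale (of_nat k * coeff ?P k) (gen s a (n + int k - 1))"
  \<comment> \<open>The shift is harmless at both ends: the term at 0 has the factor k = 0, and the
    one at \<open>Suc ?d\<close> lies beyond the degree.\<close>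
  have "(\<Sum>k\<le>?d. ?g (Suc k)) = (\<Sum>k\<le>Suc ?d. ?g k)"
    by (subst sum.atMost_Suc_shift) simp
  also have "\<dots> = (\<Sum>k\<le>?d. ?g k)"
    by (simp add: coeff_eq_0)
  finally have shift: "(\<Sum>k\<le>?d. ?g (Suc k)) = (\<Sum>k\<le>?d. ?g k)" .
  have "D (poly_gen s a n) = (\<Sum>k\<le>?d. ?g (Suc k)) -
    (\<Sum>k\<le>?d. check_scale (of_int (n + int k) * coeff ?P k) (gen s a (n + int k - 1)))"
    unfolding poly_gen_def D_sum sum_subtractf[symmetric]
    by (intro sum.cong refl)
      (simp add: D_linear fls_deriv_coeff_poly_shift mult.commute[of "coeff ?P _"] del: of_int_add)
  also have "\<dots> = (\<Sum>k\<le>?d. - check_scale (of_int n * coeff ?P k) (gen s a (n + int k - 1)))"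
    unfolding shift sum_subtractf[symmetric]
    by (intro sum.cong refl) (simp add: distrib_right check.scale_left_distrib)
  also have "\<dots> = - check_scale (of_int n) (poly_gen s a (n - 1))"
    by (simp add: poly_gen_def check.scale_sum_right sum_negf algebra_simps)
  finally show ?thesis .
qed

text \<open>This is the Leibniz rule for the cocycle. With both flags set it comes down to m(m-1-n)
  + n(m-n+1) = (m-n)(m+n-1).\<close>

lemma fls_deriv_cocycle:
  "fls_deriv (cocycle s m r n) =
    - (of_int m * cocycle s (m - 1) r n) - of_int n * cocycle s m r (n - 1)"
proof (cases "s \<and> r")
  case True
  have half: "fls_deriv (of_int k / 2 * f) = of_int k / 2 * fls_deriv f" for k and f :: "complex fls"
  proof -
    have "of_int k / 2 = (fls_const (of_int k / 2) :: complex fls)"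
      using fls_const_half[of "of_int k"] by (simp add: fls_of_int)
    then show ?thesis by simp
  qed
  have idx: "m - 1 + n = m + n - 1" "m + (n - 1) = m + n - 1" by simp_all
  have "fls_deriv (cocycle s m r n) =
    of_int (m - n) / 2 * (of_int (1 - (m + n)) * shift_coeff p (m + n - 1))"
    by (simp only: cocycle_def True simp_thms if_True half fls_deriv_shift_coeff)
  also have "\<dots> = - (of_int m * (of_int (m - 1 - n) / 2 * shift_coeff p (m + n - 1)))
    - of_int n * (of_int (m - (n - 1)) / 2 * shift_coeff p (m + n - 1))"
    by (simp add: field_simps)
  finally show ?thesis
    by (simp only: cocycle_def True simp_thms if_True idx)
next
  case False
  show ?thesis
  \<comment> \<open>For two clear flags the left side is zero; the terms on the right are supported
    on m + n = 1, where they cancel.\<close>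
  proof (cases "m + n = 1")
    case True
    then have n: "n = 1 - m" by simp
    show ?thesis
      using False unfolding n by (auto simp: cocycle_def algebra_simps)
  next
    case False
    with \<open>\<not> (s \<and> r)\<close> show ?thesis
      by (auto simp: cocycle_def)
  qed
qed

lemma D_gen_bracket:
  "D (gen_bracket s a m r b n) =
    - check_scale (of_int m) (gen_bracket s a (m - 1) r b n) -
    check_scale (of_int n) (gen_bracket s a m r b (n - 1))"
proof -
  have idx: "m - 1 + n = m + n - 1" "m + (n - 1) = m + n - 1" by simp_all
  show ?thesis
    unfolding gen_bracket_def idx
    by (simp add: D_linear D_poly_gen fls_deriv_cocycle check.scale_left_distrib
        check.scale_left_diff_distrib check.scale_right_distrib algebra_simps)
qed

lemma bracket_minus: "br (- x) y = - br x y" "br x (- y) = - br x y"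
  using bracket_linear(1)[of x "- x" y] bracket_linear(2)[of x y "- y"]
  by (simp_all add: bracket_zero eq_neg_iff_add_eq_0 add.commute)

text \<open>Multiplying an argument by f adds the same f' term to both sides, so the rule need only
  be checked on unscaled generators and k.\<close>

lemma D_leibniz: "D (br x y) = br (D x) y + br x (D y)"
proof -
  have scale: "D (br (check_scale f x) y) = br (D (check_scale f x)) y + br (check_scale f x) (D y)"
    if "D (br x y) = br (D x) y + br x (D y)" for f x y
    using that by (simp add: D_linear bracket_linear check.scale_right_distrib add.assoc)
  have scale': "D (br x (check_scale f y)) = br (D x) (check_scale f y) + br x (D (check_scale f y))"
    if "D (br x y) = br (D x) y + br x (D y)" for f x y
    using that by (simp add: D_linear bracket_linear check.scale_right_distrib ac_simps)
  have D_zero: "D 0 = 0" using D_linear(1)[of 0 0] by simp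
  have leibniz_gen: "D (br (gen s a m) y) = br (D (gen s a m)) y + br (gen s a m) (D y)" for s a m y
  proof (induction y rule: gen_induct)
    case (gen f r b n)
    show ?case
      by (rule scale') (simp add: D_linear D_gen_bracket bracket_gen bracket_linear bracket_minus)
  next
    case (central f)
    show ?case
      by (rule scale') (simp add: D_linear bracket_central bracket_zero D_zero)
  qed (simp add: D_linear bracket_linear)
  show ?thesis
  proof (induction x rule: gen_induct)
    case (gen f s a m)
    show ?case by (rule scale) (rule leibniz_gen)
  next
    case (central f)
    show ?case
      by (rule scale) (simp add: D_linear bracket_central bracket_zero D_zero)
  qed (simp add: D_linear bracket_linear)
qed

lemma lie_derivation_D: "lie_derivation check_scaleC br D"
proof -
  interpret L: lie_algebra check_scale br by (rule lie_algebra_bracket)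
  have "vector_space (check_scaleC :: _ \<Rightarrow> ('g, 'h) check_space \<Rightarrow> _)"
    unfolding check_scaleC_eq by (rule cvec.vector_space_axioms)
  moreover have "bilinearC br"
    unfolding bilinearC_iff scaleC_check_space by (simp add: bracket_linear)
  \<comment> \<open>The product rule gives linearity over the complex numbers because constants have
    derivative zero.\<close>
  moreover have "Vector_Spaces.linear scaleC scaleC D"
    unfolding linear_scaleC_iff scaleC_check_space by (simp add: D_linear)
  ultimately show ?thesis
    using L.alternating L.jacobi D_leibniz
    by (simp add: lie_derivation_def lie_derivation_axioms_def lie_algebra_def lie_algebra_axioms_def
        check_scaleC_eq)
qed

end

theorem proposition3p9:
  fixes lie :: "'g::complex_vector \<Rightarrow> 'g \<Rightarrow> 'g"
    and form :: "'g \<Rightarrow> 'g \<Rightarrow> complex"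
    and up :: "'g \<Rightarrow> 'h::complex_vector"
    and p :: "complex poly"
  assumes "metric_lie_algebra scaleC lie form"
    and "Vector_Spaces.linear scaleC scaleC up" and "bij up"
  shows "(\<exists>!br. is_check_bracket lie form up p br) \<and>
    (\<exists>!D :: ('g, 'h) check_space \<Rightarrow> ('g, 'h) check_space. is_check_D D) \<and>
    (\<forall>br. is_check_bracket lie form up p br \<longrightarrow>
      lie_algebra check_scale br \<and>
      (\<forall>D. is_check_D D \<longrightarrow> lie_derivation check_scaleC br D))"
proof -
  interpret check_bracket_data lie form up p
    using assms by (simp add: check_bracket_data_def check_bracket_data_axioms_def)
  have bracket: "check_bracket lie form up p br" if "is_check_bracket lie form up p br" for br
    by unfold_locales (rule that)
  have "\<exists>!br. is_check_bracket lie form up p br"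
    using ex_check_bracket check_bracket.bracket_unique[OF bracket] by blast
  moreover have "\<exists>!D :: ('g, 'h) check_space \<Rightarrow> ('g, 'h) check_space. is_check_D D"
    using ex_check_D check_D_unique by blast
  moreover have "lie_derivation check_scaleC br D"
    if "is_check_bracket lie form up p br" "is_check_D D" for br D
  proof -
    interpret check_bracket_derivation lie form up p br D
      using bracket[OF that(1)] that(2)
      by (simp add: check_bracket_derivation_def check_bracket_derivation_axioms_def)
    show ?thesis by (rule lie_derivation_D)
  qed
  ultimately show ?thesis
    using check_bracket.lie_algebra_bracket[OF bracket] by blast
qed

end
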